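(* Let $\xi\in L^n_{\psi_2}(\Omega)$ be an $n$-dimensional sub-gaussian random vector (coordinates not necessarily independent, not necessarily centered) and let $A$ be a real $n\times n$ matrix. Then $\langle A\xi,\xi\rangle\in L_{\psi_1}(\Omega)$ and $$\|\langle A\xi,\xi\rangle\|_{\psi_1}\le \|A\|_{tr}\,\|\xi\|_{\psi_2}^2 .$$
   Context: $(\Omega,\mathcal F,\mathbb P)$ is a probability space; $\langle\cdot,\cdot\rangle$ and $|\cdot|_2$ are the standard inner product and Euclidean norm on $\mathbb R^n$, and $S^{n-1}=\{\mathbf t\in\mathbb R^n:|\mathbf t|_2=1\}$. For a real random variable $\eta$, $\|\eta\|_{\psi_1}=\inf\{K>0:\ \mathbb E\exp(|\eta|/K)\le 2\}$ and $\|\eta\|_{\psi_2}=\inf\{K>0:\ \mathbb E\exp(\eta^2/K^2)\le 2\}$. $L_{\psi_1}(\Omega)$ (sub-exponential random variables) is the space of random variables with $\|\eta\|_{\psi_1}<\infty$. For a random vector $\xi$ in $\mathbb R^n$, $\|\xi\|_{\psi_2}=\sup_{\mathbf t\in S^{n-1}}\|\langle\xi,\mathbf t\rangle\|_{\psi_2}=\inf\{K>0:\ \sup_{\mathbf t\in S^{n-1}}\mathbb E\exp(\langle\xi,\mathbf t\rangle^2/K^2)\le 2\}$. $L^n_{\psi_2}(\Omega)$ is the space of $n$-dimensional sub-gaussian random vectors, i.e. those with $\|\xi\|_{\psi_2}<\infty$. $\|A\|_{tr}=\mathrm{trace}\big((AA^T)^{1/2}\big)$ is the trace norm of $A$ (the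 sum of its singular values). *)

theory Defs
  imports "HOL-Probability.Probability"
begin

text \<open>
  The norms take values in \<^typ>\<open>ennreal\<close>, so the infimum over the empty set is \<^term>\<open>\<infinity> :: ennreal\<close>,
  and the expectations are nonnegative Lebesgue integrals, which are \<^term>\<open>\<infinity> :: ennreal\<close> (rather
  than \<open>0\<close>) when the exponential moment does not exist.
\<close>

definition psi1_norm :: "'w measure \<Rightarrow> ('w \<Rightarrow> real) \<Rightarrow> ennreal" where
  "psi1_norm M \<eta> =
     Inf {ennreal K |K. K > 0 \<and> (\<integral>\<^sup>+ \<omega>. ennreal (exp (\<bar>\<eta> \<omega>\<bar> / K)) \<partial>M) \<le> 2}"

definition psi2_norm :: "'w measure \<Rightarrow> ('w \<Rightarrow> real) \<Rightarrow> ennreal" where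
  "psi2_norm M \<eta> =
     Inf {ennreal K |K. K > 0 \<and> (\<integral>\<^sup>+ \<omega>. ennreal (exp ((\<eta> \<omega>)\<^sup>2 / K\<^sup>2)) \<partial>M) \<le> 2}"

definition L_psi1 :: "'w measure \<Rightarrow> ('w \<Rightarrow> real) set" where
  "L_psi1 M = {\<eta> \<in> borel_measurable M. psi1_norm M \<eta> < \<infinity>}"

definition psi2_vec_norm :: "'w measure \<Rightarrow> ('w \<Rightarrow> real ^ 'n) \<Rightarrow> ennreal" where
  "psi2_vec_norm M \<xi> = (SUP t \<in> sphere 0 1. psi2_norm M (\<lambda>\<omega>. \<xi> \<omega> \<bullet> t))"

definition L_psi2_vec :: "'w measure \<Rightarrow> ('w \<Rightarrow> real ^ 'n) set" where
  "L_psi2_vec M = {\<xi> \<in> borel_measurable M. psi2_vec_norm M \<xi> < \<infinity>}"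

definition psd_matrix :: "real ^ 'n ^ 'n \<Rightarrow> bool" where
  "psd_matrix B \<longleftrightarrow> transpose B = B \<and> (\<forall>x. 0 \<le> (B *v x) \<bullet> x)"

text \<open>
  The description is meaningful only for positive semidefinite \<open>B\<close>, which have exactly one
  positive semidefinite square root; it is applied below to \<open>A ** transpose A\<close>.
\<close>

definition matrix_sqrt :: "real ^ 'n ^ 'n \<Rightarrow> real ^ 'n ^ 'n" where
  "matrix_sqrt B = (THE C. psd_matrix C \<and> C ** C = B)"

definition trace_norm :: "real ^ 'n ^ 'n \<Rightarrow> real" where
  "trace_norm A = trace (matrix_sqrt (A ** transpose A))"

end

theory Submission
  imports Defs
begin

text \<open>
  Let \<open>u\<close> run over an orthonormal eigenbasis of \<open>A ** transpose A\<close>. The number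
  \<open>s u = norm (transpose A *v u)\<close> is then a singular value of \<open>A\<close>, and writing
  \<open>transpose A *v u = s u *\<^sub>R v u\<close> with a unit vector \<open>v u\<close> gives
  \<open>(A *v x) \<bullet> x = (\<Sum>u. s u * ((v u \<bullet> x) * (u \<bullet> x)))\<close>, where the weights \<open>s u\<close> sum to the
  trace norm (\<open>trace_norm_decomposition\<close>). So the quadratic form is a combination of products of
  two one-dimensional marginals of \<open>\<xi>\<close> in unit directions, each of which has a \<open>\<psi>\<^sub>2\<close>-norm of at
  most that of \<open>\<xi>\<close>.

  Convexity of \<open>exp\<close> does the rest. By \<open>\<bar>x * y\<bar> \<le> (x\<^sup>2 + y\<^sup>2) / 2\<close>, a product of two variables
  whose \<open>\<psi>\<^sub>2\<close>-norms are below \<open>L\<close> satisfies the \<open>\<psi>\<^sub>1\<close>-moment condition at scale \<open>L\<^sup>2\<close>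
  (\<open>exp_moment_product_le\<close>), and averaging with weights \<open>s u / T\<close>, for any \<open>T > trace_norm A\<close>,
  shows that the quadratic form satisfies it at scale \<open>T * L\<^sup>2\<close>
  (\<open>exp_moment_convex_combination_le\<close>). Letting \<open>T\<close> and \<open>L\<close> decrease to the two norms gives the bound.

  The linear algebra rests on the spectral theorem (\<open>selfadjoint_eigenbasis_subspace\<close>) and on the
  uniqueness of the positive semidefinite square root. The latter is obtained by showing that any
  such root of \<open>P\<close> acts on the eigenvectors of \<open>P\<close> in the expected way
  (\<open>psd_sqrt_eigenvector\<close>), so the root itself never has to be diagonalised.
\<close>

section \<open>The spectral theorem\<close>

lemma quadratic_nonneg_linear_coeff:
  fixes a b :: real
  assumes "\<And>t. 0 \<le> t\<^sup>2 * a - 2 * t * b"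
  shows "b = 0"
proof (rule ccontr)
  assume b: "b \<noteq> 0"
  \<comment> \<open>If \<open>a\<close> is replaced by the larger, positive \<open>\<bar>a\<bar> + 1\<close>, this \<open>t\<close> minimises the quadratic.\<close>
  define t where "t = b / (\<bar>a\<bar> + 1)"
  have pos: "\<bar>a\<bar> + 1 > 0" by linarith
  have "t\<^sup>2 * a - 2 * t * b \<le> t\<^sup>2 * (\<bar>a\<bar> + 1) - 2 * t * b"
    by (intro diff_right_mono mult_left_mono) auto
  also have "\<dots> = - (b\<^sup>2 / (\<bar>a\<bar> + 1))"
  proof -
    have "t * (\<bar>a\<bar> + 1) = b" using pos by (simp add: t_def)
    then have "t\<^sup>2 * (\<bar>a\<bar> + 1) = t * b" by (simp add: power2_eq_square mult.assoc)
    then show ?thesis by (simp add: t_def power2_eq_square)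
  qed
  also have "\<dots> < 0" using b pos by simp
  finally show False using assms[of t] by linarith
qed

text \<open>
  A maximiser \<open>u\<close> of the Rayleigh quotient \<open>f x \<bullet> x\<close> on the unit sphere of \<open>S\<close> is an eigenvector: by
  first-order optimality, \<open>f u\<close> is orthogonal to every vector of \<open>S\<close> that is orthogonal to \<open>u\<close>, and
  invariance keeps \<open>f u\<close> inside \<open>S\<close>.
\<close>

lemma selfadjoint_eigenvector_exists:
  fixes f :: "'a::euclidean_space \<Rightarrow> 'a"
  assumes f: "linear f" and sa: "\<And>x y. f x \<bullet> y = x \<bullet> f y"
    and S: "subspace S" and inv: "\<And>x. x \<in> S \<Longrightarrow> f x \<in> S" and nz: "x0 \<in> S" "x0 \<noteq> 0"
  obtains u c where "u \<in> S" "norm u = 1" "f u = c *\<^sub>R u"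
proof -
  interpret linear f by (rule f)
  let ?K = "S \<inter> sphere 0 1"
  have "compact ?K" using S by (simp add: closed_Int_compact closed_subspace)
  moreover have "?K \<noteq> {}"
  proof -
    have "x0 /\<^sub>R norm x0 \<in> ?K" using nz S by (simp add: subspace_scale)
    then show ?thesis by blast
  qed
  moreover have "continuous_on ?K (\<lambda>x. f x \<bullet> x)"
    by (intro continuous_intros linear_continuous_on linear_conv_bounded_linear[THEN iffD1] f)
  ultimately obtain u where u: "u \<in> ?K" and max: "\<And>y. y \<in> ?K \<Longrightarrow> f y \<bullet> y \<le> f u \<bullet> u"
    using continuous_attains_sup[of ?K] by blast
  define c where "c = f u \<bullet> u"
  have uS: "u \<in> S" and nu: "u \<bullet> u = 1" using u by (auto simp: norm_eq_1)
  have bound: "f y \<bullet> y \<le> c * (y \<bullet> y)" if y: "y \<in> S" for y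
  proof (cases "y = 0")
    case False
    then have "y /\<^sub>R norm y \<in> ?K" using S y by (simp add: subspace_scale)
    from max[OF this] have "(f y \<bullet> y) / (norm y)\<^sup>2 \<le> c"
      by (simp add: scale c_def power2_eq_square field_simps)
    then show ?thesis using False by (simp add: dot_square_norm field_simps)
  qed (simp add: zero)
  have orth: "f u \<bullet> w = 0" if w: "w \<in> S" "u \<bullet> w = 0" for w
  proof (rule quadratic_nonneg_linear_coeff)
    fix t :: real
    have "u + t *\<^sub>R w \<in> S" using uS w S by (simp add: subspace_add subspace_scale)
    note b = bound[OF this]
    have "f w \<bullet> u = f u \<bullet> w" by (metis sa inner_commute)
    then show "0 \<le> t\<^sup>2 * (c * (w \<bullet> w) - f w \<bullet> w) - 2 * t * (f u \<bullet> w)"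
      using b w(2) nu
      by (simp add: add scale inner_add_left inner_add_right c_def[symmetric] inner_commute[of w u])
         (simp add: algebra_simps power2_eq_square)
  qed
  \<comment> \<open>The component of \<open>f u\<close> orthogonal to \<open>u\<close> is itself an admissible direction.\<close>
  define w where "w = f u - c *\<^sub>R u"
  have wS: "w \<in> S" unfolding w_def using S uS inv by (simp add: subspace_diff subspace_scale)
  have uw: "u \<bullet> w = 0" by (simp add: w_def inner_diff_right nu c_def inner_commute)
  have "w \<bullet> w = f u \<bullet> w - c * (u \<bullet> w)" by (simp add: w_def inner_diff_left)
  then have "w = 0" using orth[OF wS uw] uw by simp
  then show thesis using that[of u c] uS nu by (simp add: w_def norm_eq_1)
qed

text \<open>
  An eigenvector is split off and the induction continues on its orthogonal complement in \<open>S\<close>, which is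
  again invariant because \<open>f\<close> is self-adjoint. Completeness of the basis is recorded as an
  expansion formula, the form in which it is used for matrices below.
\<close>

lemma selfadjoint_eigenbasis_subspace:
  fixes f :: "'a::euclidean_space \<Rightarrow> 'a"
  assumes f: "linear f" and sa: "\<And>x y. f x \<bullet> y = x \<bullet> f y"
    and "subspace S" and "\<And>x. x \<in> S \<Longrightarrow> f x \<in> S"
  shows "\<exists>B. finite B \<and> B \<subseteq> S \<and> (\<forall>u\<in>B. \<forall>v\<in>B. u \<bullet> v = (if u = v then 1 else 0))
    \<and> (\<forall>u\<in>B. \<exists>c. f u = c *\<^sub>R u) \<and> (\<forall>x\<in>S. x = (\<Sum>u\<in>B. (x \<bullet> u) *\<^sub>R u))"
  using assms(3,4)
proof (induction "dim S" arbitrary: S rule: less_induct)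
  case less
  show ?case
  proof (cases "S \<subseteq> {0}")
    case True
    then show ?thesis by (intro exI[of _ "{}"]) auto
  next
    case False
    then obtain x0 where "x0 \<in> S" "x0 \<noteq> 0" by auto
    from less.prems this obtain u c where u: "u \<in> S" "norm u = 1" "f u = c *\<^sub>R u"
      by (rule selfadjoint_eigenvector_exists[OF f sa])
    have nu: "u \<bullet> u = 1" using u(2) by (simp add: norm_eq_1)
    define S' where "S' = S \<inter> {x. u \<bullet> x = 0}"
    have S': "subspace S'" unfolding S'_def
      by (intro subspace_inter less.prems subspace_hyperplane)
    have "u \<notin> S'" using nu by (simp only: S'_def) auto
    then have "S' \<subset> S" using u(1) unfolding S'_def by blast
    then have "dim S' < dim S"
      using dim_psubset[of S' S] S' less.prems(1) by (simp add: span_eq_iff[THEN iffD2])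
    moreover have "f x \<in> S'" if "x \<in> S'" for x
      using that less.prems(2) sa[of u x, symmetric] u(3) by (auto simp: S'_def)
    ultimately obtain B where B: "finite B" "B \<subseteq> S'"
      "\<forall>u\<in>B. \<forall>v\<in>B. u \<bullet> v = (if u = v then 1 else 0)"
      "\<forall>u\<in>B. \<exists>c. f u = c *\<^sub>R u" "\<forall>x\<in>S'. x = (\<Sum>u\<in>B. (x \<bullet> u) *\<^sub>R u)"
      using less.hyps[of S'] S' by blast
    have uB: "v \<bullet> u = 0" "u \<bullet> v = 0" if "v \<in> B" for v
      using that B(2) by (auto simp: S'_def inner_commute)
    have "u \<notin> B" using uB nu by fastforce
    show ?thesis
    proof (intro exI[of _ "insert u B"] conjI)
      show "\<forall>v\<in>insert u B. \<forall>w\<in>insert u B. v \<bullet> w = (if v = w then 1 else 0)"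
        using B(3) uB nu \<open>u \<notin> B\<close> by auto
      show "\<forall>x\<in>S. x = (\<Sum>v\<in>insert u B. (x \<bullet> v) *\<^sub>R v)"
      proof
        fix x assume x: "x \<in> S"
        define y where "y = x - (x \<bullet> u) *\<^sub>R u"
        have "y \<in> S'" unfolding S'_def y_def using x u nu less.prems(1)
          by (auto simp: subspace_diff subspace_scale inner_diff_right inner_commute)
        then have "y = (\<Sum>v\<in>B. (y \<bullet> v) *\<^sub>R v)" using B(5) by blast
        also have "\<dots> = (\<Sum>v\<in>B. (x \<bullet> v) *\<^sub>R v)"
          by (intro sum.cong refl) (simp add: y_def inner_diff_left uB)
        finally show "x = (\<Sum>v\<in>insert u B. (x \<bullet> v) *\<^sub>R v)"
          using B(1) \<open>u \<notin> B\<close> by (simp add: y_def algebra_simps)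
      qed
    qed (use B u in \<open>auto simp: S'_def\<close>)
  qed
qed

section \<open>The trace norm as a sum of singular values\<close>

lemma inner_matrix_vector_mult_transpose:
  fixes A :: "real ^ 'n ^ 'm"
  shows "(A *v x) \<bullet> y = x \<bullet> (transpose A *v y)"
  by (metis dot_lmul_matrix inner_commute transpose_matrix_vector)

text \<open>
  Factor \<open>C\<^sup>2 - s\<^sup>2 = (C + s) (C - s)\<close>. For \<open>s > 0\<close> the vector \<open>w = C u - s u\<close> would be an eigenvector
  for the eigenvalue \<open>-s < 0\<close>, which positivity excludes unless \<open>w = 0\<close>; for \<open>s = 0\<close> symmetry gives
  \<open>(norm (C u))\<^sup>2 = C\<^sup>2 u \<bullet> u = 0\<close>.
\<close>

lemma psd_sqrt_eigenvector:
  fixes C :: "real ^ 'n ^ 'n"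
  assumes C: "psd_matrix C" and eig: "(C ** C) *v u = (s\<^sup>2) *\<^sub>R u" and s: "s \<ge> 0"
  shows "C *v u = s *\<^sub>R u"
proof (cases "s = 0")
  case True
  have "(C *v u) \<bullet> (C *v u) = u \<bullet> ((C ** C) *v u)"
    using C by (simp add: inner_matrix_vector_mult_transpose psd_matrix_def matrix_vector_mul_assoc)
  then show ?thesis using eig True by simp
next
  case False
  define w where "w = C *v u - s *\<^sub>R u"
  have "C *v w = - s *\<^sub>R w"
    using eig by (simp add: w_def matrix_vector_mult_diff_distrib matrix_vector_mul_assoc
        matrix_vector_mult_scaleR algebra_simps power2_eq_square)
  then have "(C *v w) \<bullet> w = - (s * (w \<bullet> w))" by simp
  moreover have "(C *v w) \<bullet> w \<ge> 0" using C by (simp add: psd_matrix_def)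
  ultimately have "s * (w \<bullet> w) \<le> 0" by linarith
  then have "w = 0" using s False
    by (metis inner_gt_zero_iff less_eq_real_def linorder_not_le mult_pos_pos)
  then show ?thesis by (simp add: w_def)
qed

text \<open>
  The right-hand side defines a positive semidefinite root of \<open>P\<close>. Every other such root agrees with
  it on the basis \<open>B\<close> and hence everywhere, so the definite description in \<open>matrix_sqrt\<close> denotes it.
\<close>

lemma matrix_sqrt_via_eigenbasis:
  fixes P :: "real ^ 'n ^ 'n"
  assumes "finite B"
    and on: "\<And>u v. u \<in> B \<Longrightarrow> v \<in> B \<Longrightarrow> u \<bullet> v = (if u = v then 1 else 0)"
    and ex: "\<And>x. x = (\<Sum>u\<in>B. (x \<bullet> u) *\<^sub>R u)"
    and eig: "\<And>u. u \<in> B \<Longrightarrow> P *v u = (s u)\<^sup>2 *\<^sub>R u" and s: "\<And>u. u \<in> B \<Longrightarrow> s u \<ge> 0"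
  shows "matrix_sqrt P *v x = (\<Sum>u\<in>B. (s u * (x \<bullet> u)) *\<^sub>R u)"
proof -
  define g where "g = (\<lambda>x. \<Sum>u\<in>B. (s u * (x \<bullet> u)) *\<^sub>R u)"
  have lin: "linear g" unfolding g_def
    by (intro linearI) (simp_all add: inner_add_left algebra_simps sum.distrib scaleR_sum_right)
  define C where "C = matrix g"
  have Cg: "C *v x = g x" for x by (simp add: C_def matrix_works lin)
  have gB: "g u = s u *\<^sub>R u" if "u \<in> B" for u
  proof -
    have "g u = (\<Sum>v\<in>B. if u = v then s u *\<^sub>R u else 0)"
      unfolding g_def using that by (intro sum.cong refl) (simp add: on)
    then show ?thesis using that \<open>finite B\<close> by simp
  qed
  have determined: "D = E" if "\<And>u. u \<in> B \<Longrightarrow> D *v u = E *v u" for D E :: "real ^ 'n ^ 'n"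
  proof -
    have "D *v x = E *v x" for x
    proof -
      have "D *v (\<Sum>u\<in>B. (x \<bullet> u) *\<^sub>R u) = E *v (\<Sum>u\<in>B. (x \<bullet> u) *\<^sub>R u)"
        using that by (simp add: linear_sum[OF matrix_vector_mul_linear] matrix_vector_mult_scaleR)
      then show ?thesis by (simp flip: ex)
    qed
    then show ?thesis by (simp add: matrix_eq)
  qed
  have gg: "g x \<bullet> y = (\<Sum>u\<in>B. s u * (x \<bullet> u) * (u \<bullet> y))" for x y
    by (simp add: g_def inner_sum_left)
  have sa: "g x \<bullet> y = x \<bullet> g y" for x y
    unfolding inner_commute[of x "g y"] gg
    by (intro sum.cong refl) (simp add: inner_commute)
  have "psd_matrix C" unfolding psd_matrix_def
  proof (intro conjI allI)
    have "x \<bullet> (transpose C *v y) = x \<bullet> (C *v y)" for x y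
      by (metis sa Cg inner_matrix_vector_mult_transpose)
    then show "transpose C = C" by (metis matrix_eq vector_eq_ldot)
    show "0 \<le> (C *v x) \<bullet> x" for x
      unfolding Cg gg by (intro sum_nonneg) (simp add: s inner_commute mult.assoc)
  qed
  moreover have "C ** C = P"
    by (rule determined)
       (simp add: matrix_vector_mul_assoc[symmetric] Cg gB linear_scale[OF lin] eig power2_eq_square)
  moreover have "D = C" if D: "psd_matrix D" "D ** D = P" for D
    by (rule determined) (simp add: Cg gB psd_sqrt_eigenvector[OF D(1)] D(2) eig s)
  ultimately have "matrix_sqrt P = C" unfolding matrix_sqrt_def by (intro the_equality) blast+
  then show ?thesis by (simp add: Cg g_def)
qed

lemma trace_rank_one_sum:
  fixes C :: "real ^ 'n ^ 'n"
  assumes C: "\<And>x. C *v x = (\<Sum>u\<in>B. (s u * (x \<bullet> u)) *\<^sub>R u)"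
    and n: "\<And>u. u \<in> B \<Longrightarrow> u \<bullet> u = 1"
  shows "trace C = sum s B"
proof -
  have "trace C = (\<Sum>k\<in>UNIV. (C *v axis k 1) $ k)"
    by (simp add: trace_def matrix_vector_mult_basis column_def)
  also have "\<dots> = (\<Sum>k\<in>UNIV. \<Sum>u\<in>B. s u * (u $ k * u $ k))"
    by (simp add: C inner_axis' sum_component mult.assoc)
  also have "\<dots> = (\<Sum>u\<in>B. s u * (u \<bullet> u))"
    by (subst sum.swap) (simp add: inner_vec_def sum_distrib_left)
  finally show ?thesis using n by simp
qed

text \<open>
  A singular value decomposition of \<open>A\<close>, stated for its quadratic form: expand the second factor in
  \<open>(A *v x) \<bullet> x\<close> in an eigenbasis of \<open>A ** transpose A\<close> and move \<open>A\<close> to the basis vectors.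
\<close>

lemma trace_norm_decomposition:
  fixes A :: "real ^ 'n ^ 'n"
  obtains B :: "(real ^ 'n) set" and v :: "real ^ 'n \<Rightarrow> real ^ 'n" and s :: "real ^ 'n \<Rightarrow> real"
  where "finite B" "\<And>u. u \<in> B \<Longrightarrow> norm u = 1" "\<And>u. u \<in> B \<Longrightarrow> norm (v u) = 1"
    "\<And>u. u \<in> B \<Longrightarrow> s u \<ge> 0" "sum s B = trace_norm A"
    "\<And>x. (A *v x) \<bullet> x = (\<Sum>u\<in>B. s u * ((v u \<bullet> x) * (u \<bullet> x)))"
proof -
  let ?P = "A ** transpose A"
  have Pin: "(?P *v x) \<bullet> y = (transpose A *v x) \<bullet> (transpose A *v y)" for x y
    by (simp add: inner_matrix_vector_mult_transpose matrix_vector_mul_assoc[symmetric])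
  have "(?P *v x) \<bullet> y = x \<bullet> (?P *v y)" for x y
    by (metis Pin inner_commute)
  then obtain B where B: "finite B" "\<forall>u\<in>B. \<forall>v\<in>B. u \<bullet> v = (if u = v then 1 else 0)"
      "\<forall>u\<in>B. \<exists>c. ?P *v u = c *\<^sub>R u" and ex: "\<And>x. x = (\<Sum>u\<in>B. (x \<bullet> u) *\<^sub>R u)"
    using selfadjoint_eigenbasis_subspace[of "(*v) ?P" UNIV] by auto
  define s where "s = (\<lambda>u. norm (transpose A *v u))"
  \<comment> \<open>If \<open>s u = 0\<close>, any unit vector will do; \<open>u\<close> is one.\<close>
  define v where "v = (\<lambda>u. if s u = 0 then u else (transpose A *v u) /\<^sub>R s u)"
  have nB: "u \<bullet> u = 1" if "u \<in> B" for u using B(2) that by simp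
  have eig: "?P *v u = (s u)\<^sup>2 *\<^sub>R u" if u: "u \<in> B" for u
  proof -
    obtain c where c: "?P *v u = c *\<^sub>R u" using B(3) u by blast
    have "c = (?P *v u) \<bullet> u" using c nB[OF u] by simp
    also have "\<dots> = (s u)\<^sup>2" unfolding Pin s_def by (rule dot_square_norm)
    finally show ?thesis using c by simp
  qed
  have sv: "transpose A *v u = s u *\<^sub>R v u" for u by (simp add: v_def s_def)
  show thesis
  proof (rule that[of B v s])
    show "finite B" by (rule B)
    show nu: "norm u = 1" if "u \<in> B" for u using nB[OF that] by (simp add: norm_eq_1)
    show "norm (v u) = 1" if "u \<in> B" for u
      using nu[OF that] by (auto simp: v_def s_def)
    show "s u \<ge> 0" for u by (simp add: s_def)
    show "sum s B = trace_norm A" unfolding trace_norm_def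
    proof (rule trace_rank_one_sum[symmetric])
      show "matrix_sqrt ?P *v x = (\<Sum>u\<in>B. (s u * (x \<bullet> u)) *\<^sub>R u)" for x
        by (rule matrix_sqrt_via_eigenbasis[OF B(1) _ ex eig]) (use B(2) in \<open>auto simp: s_def\<close>)
    qed (rule nB)
    show "(A *v x) \<bullet> x = (\<Sum>u\<in>B. s u * ((v u \<bullet> x) * (u \<bullet> x)))" for x
    proof -
      have "(A *v x) \<bullet> x = (A *v x) \<bullet> (\<Sum>u\<in>B. (x \<bullet> u) *\<^sub>R u)" by (simp flip: ex)
      also have "\<dots> = (\<Sum>u\<in>B. (x \<bullet> u) * (x \<bullet> (s u *\<^sub>R v u)))"
        by (simp add: inner_sum_right inner_matrix_vector_mult_transpose sv del: transpose_matrix_vector)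
      finally show ?thesis by (simp add: inner_commute mult_ac)
    qed
  qed
qed

section \<open>Exponential moments\<close>

text \<open>
  Jensen's inequality for \<open>exp\<close>, with the missing weight \<open>1 - sum w I\<close> placed at the point \<open>0\<close>. The
  proof averages the tangent-line bound for \<open>exp\<close> at the mean \<open>m\<close>. Allowing total weight below \<open>1\<close>
  makes it possible to divide by a quantity slightly larger than the trace norm, which covers
  \<open>A = 0\<close> without a case distinction.
\<close>

lemma exp_convex_combination_le:
  fixes w y :: "'i \<Rightarrow> real"
  assumes w: "\<And>i. i \<in> I \<Longrightarrow> 0 \<le> w i" and le: "sum w I \<le> 1"
  shows "exp (\<Sum>i\<in>I. w i * y i) \<le> (\<Sum>i\<in>I. w i * exp (y i)) + (1 - sum w I)"
proof -
  define m where "m = (\<Sum>i\<in>I. w i * y i)"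
  have tangent: "exp m * (1 + (z - m)) \<le> exp z" for z
  proof -
    have "exp m * (1 + (z - m)) \<le> exp m * exp (z - m)"
      by (intro mult_left_mono exp_ge_add_one_self) simp
    then show ?thesis by (simp add: exp_add[symmetric])
  qed
  have "exp m = (\<Sum>i\<in>I. w i * (exp m * (1 + (y i - m)))) + (1 - sum w I) * (exp m * (1 + (0 - m)))"
  proof -
    have "(\<Sum>i\<in>I. w i * (exp m * (1 + (y i - m))))
        = (\<Sum>i\<in>I. exp m * (1 - m) * w i + exp m * (w i * y i))"
      by (intro sum.cong refl) (simp add: algebra_simps)
    also have "\<dots> = exp m * (1 - m) * sum w I + exp m * m"
      by (simp add: sum.distrib sum_distrib_left[symmetric] m_def)
    finally show ?thesis by (simp add: algebra_simps)
  qed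
  also have "\<dots> \<le> (\<Sum>i\<in>I. w i * exp (y i)) + (1 - sum w I) * exp 0"
    using w le by (intro add_mono sum_mono mult_left_mono tangent) auto
  finally show ?thesis by (simp add: m_def)
qed

lemma (in prob_space) exp_moment_convex_combination_le:
  fixes w :: "'i \<Rightarrow> real" and Y :: "'i \<Rightarrow> 'a \<Rightarrow> real"
  assumes w: "\<And>i. i \<in> I \<Longrightarrow> 0 \<le> w i" "sum w I \<le> 1"
    and [measurable]: "\<And>i. i \<in> I \<Longrightarrow> Y i \<in> borel_measurable M"
    and Y: "\<And>i. i \<in> I \<Longrightarrow> (\<integral>\<^sup>+ \<omega>. ennreal (exp (Y i \<omega>)) \<partial>M) \<le> 2"
  shows "(\<integral>\<^sup>+ \<omega>. ennreal (exp (\<Sum>i\<in>I. w i * Y i \<omega>)) \<partial>M) \<le> 2"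
proof -
  have "(\<integral>\<^sup>+ \<omega>. ennreal (exp (\<Sum>i\<in>I. w i * Y i \<omega>)) \<partial>M)
      \<le> (\<integral>\<^sup>+ \<omega>. (\<Sum>i\<in>I. ennreal (w i) * ennreal (exp (Y i \<omega>))) + ennreal (1 - sum w I) \<partial>M)"
  proof (rule nn_integral_mono)
    fix \<omega>
    have "(\<Sum>i\<in>I. ennreal (w i) * ennreal (exp (Y i \<omega>))) + ennreal (1 - sum w I)
        = ennreal ((\<Sum>i\<in>I. w i * exp (Y i \<omega>)) + (1 - sum w I))"
      using w by (simp add: ennreal_mult'[symmetric] sum_ennreal sum_nonneg)
    then show "ennreal (exp (\<Sum>i\<in>I. w i * Y i \<omega>))
      \<le> (\<Sum>i\<in>I. ennreal (w i) * ennreal (exp (Y i \<omega>))) + ennreal (1 - sum w I)"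
      using exp_convex_combination_le[OF w, of "\<lambda>i. Y i \<omega>"] by (simp add: ennreal_leI)
  qed
  also have "\<dots> = (\<Sum>i\<in>I. ennreal (w i) * (\<integral>\<^sup>+ \<omega>. ennreal (exp (Y i \<omega>)) \<partial>M)) + ennreal (1 - sum w I)"
    by (simp add: nn_integral_add nn_integral_sum nn_integral_cmult emeasure_space_1)
  also have "\<dots> \<le> (\<Sum>i\<in>I. ennreal (w i) * 2) + ennreal (1 - sum w I) * 2"
  proof (intro add_mono sum_mono mult_left_mono Y)
    show "ennreal (1 - sum w I) \<le> ennreal (1 - sum w I) * 2"
      using mult_left_mono[of 1 "2::ennreal" "ennreal (1 - sum w I)"] by simp
  qed auto
  also have "\<dots> = (ennreal (sum w I) + ennreal (1 - sum w I)) * 2"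
    using w by (simp add: sum_distrib_right[symmetric] sum_ennreal distrib_right)
  also have "ennreal (sum w I) + ennreal (1 - sum w I) = ennreal (sum w I + (1 - sum w I))"
    using w by (intro ennreal_plus[symmetric]) (auto simp: sum_nonneg)
  also have "\<dots> * 2 = 2" by simp
  finally show ?thesis .
qed

text \<open>
  Admissible scales are upward closed, so every scale strictly above the infimum is admissible.
  At the infimum itself this would require a limit argument, which the strict inequality avoids.
\<close>

lemma psi2_norm_less_imp_exp_moment_le:
  assumes less: "psi2_norm M \<eta> < ennreal L"
  shows "(\<integral>\<^sup>+ \<omega>. ennreal (exp ((\<eta> \<omega>)\<^sup>2 / L\<^sup>2)) \<partial>M) \<le> 2"
proof -
  obtain K where K: "K > 0" "K < L" "(\<integral>\<^sup>+ \<omega>. ennreal (exp ((\<eta> \<omega>)\<^sup>2 / K\<^sup>2)) \<partial>M) \<le> 2"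
    using less unfolding psi2_norm_def Inf_less_iff by (auto simp: ennreal_less_iff)
  have "(\<integral>\<^sup>+ \<omega>. ennreal (exp ((\<eta> \<omega>)\<^sup>2 / L\<^sup>2)) \<partial>M)
      \<le> (\<integral>\<^sup>+ \<omega>. ennreal (exp ((\<eta> \<omega>)\<^sup>2 / K\<^sup>2)) \<partial>M)"
    using K by (intro nn_integral_mono ennreal_leI) (auto intro!: divide_left_mono power_mono)
  with K(3) show ?thesis by order
qed

text \<open>
  \<open>\<bar>X * Y\<bar>\<close> is at most the average of \<open>X\<^sup>2\<close> and \<open>Y\<^sup>2\<close>, and the moment condition passes to averages. The
  average is taken over the index type \<open>bool\<close>.
\<close>

lemma (in prob_space) exp_moment_product_le:
  fixes X Y :: "'a \<Rightarrow> real"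
  assumes [measurable]: "X \<in> borel_measurable M" "Y \<in> borel_measurable M"
    and X: "(\<integral>\<^sup>+ \<omega>. ennreal (exp ((X \<omega>)\<^sup>2 / c)) \<partial>M) \<le> 2"
    and Y: "(\<integral>\<^sup>+ \<omega>. ennreal (exp ((Y \<omega>)\<^sup>2 / c)) \<partial>M) \<le> 2" and c: "c > 0"
  shows "(\<integral>\<^sup>+ \<omega>. ennreal (exp (\<bar>X \<omega> * Y \<omega>\<bar> / c)) \<partial>M) \<le> 2"
proof -
  have "\<bar>X \<omega> * Y \<omega>\<bar> / c \<le> (\<Sum>b\<in>UNIV. 1 / 2 * ((if b then X \<omega> else Y \<omega>)\<^sup>2 / c))" for \<omega>
  proof -
    have "2 * \<bar>X \<omega> * Y \<omega>\<bar> \<le> (X \<omega>)\<^sup>2 + (Y \<omega>)\<^sup>2"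
      using sum_squares_bound[of "\<bar>X \<omega>\<bar>" "\<bar>Y \<omega>\<bar>"] by (simp add: abs_mult)
    then show ?thesis using c by (simp add: UNIV_bool field_simps)
  qed
  then have "(\<integral>\<^sup>+ \<omega>. ennreal (exp (\<bar>X \<omega> * Y \<omega>\<bar> / c)) \<partial>M)
     \<le> (\<integral>\<^sup>+ \<omega>. ennreal (exp (\<Sum>b\<in>UNIV. 1 / 2 * ((if b then X \<omega> else Y \<omega>)\<^sup>2 / c))) \<partial>M)"
    by (intro nn_integral_mono ennreal_leI) simp
  also have "\<dots> \<le> 2"
  proof (rule exp_moment_convex_combination_le)
    fix b :: bool
    show "(\<integral>\<^sup>+ \<omega>. ennreal (exp ((if b then X \<omega> else Y \<omega>)\<^sup>2 / c)) \<partial>M) \<le> 2"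
      using X Y by (cases b) auto
  qed (auto simp: UNIV_bool)
  finally show ?thesis .
qed

section \<open>The quadratic form\<close>

theorem proposition2p4:
  fixes M :: "'w measure"
    and \<xi> :: "'w \<Rightarrow> real ^ 'n"
    and A :: "real ^ 'n ^ 'n"
  assumes "prob_space M"
    and "\<xi> \<in> L_psi2_vec M"
  shows "(\<lambda>\<omega>. (A *v \<xi> \<omega>) \<bullet> \<xi> \<omega>) \<in> L_psi1 M
    \<and> psi1_norm M (\<lambda>\<omega>. (A *v \<xi> \<omega>) \<bullet> \<xi> \<omega>)
        \<le> ennreal (trace_norm A) * (psi2_vec_norm M \<xi>)\<^sup>2"
proof -
  interpret prob_space M by fact
  have meas[measurable]: "\<xi> \<in> borel_measurable M" and fin: "psi2_vec_norm M \<xi> < \<infinity>"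
    using assms(2) by (auto simp: L_psi2_vec_def)
  obtain n where n: "n \<ge> 0" "psi2_vec_norm M \<xi> = ennreal n"
    using fin by (cases "psi2_vec_norm M \<xi>") auto
  obtain B :: "(real ^ 'n) set" and v :: "real ^ 'n \<Rightarrow> real ^ 'n" and s :: "real ^ 'n \<Rightarrow> real"
    where B: "finite B"
    and nu: "\<And>u. u \<in> B \<Longrightarrow> norm u = 1" and nv: "\<And>u. u \<in> B \<Longrightarrow> norm (v u) = 1"
    and s: "\<And>u. u \<in> B \<Longrightarrow> s u \<ge> 0" and tr: "sum s B = trace_norm A"
    and q: "\<And>x. (A *v x) \<bullet> x = (\<Sum>u\<in>B. s u * ((v u \<bullet> x) * (u \<bullet> x)))"
    by (rule trace_norm_decomposition[of A]) (rule that)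
  have tr0: "trace_norm A \<ge> 0" using s by (simp flip: tr add: sum_nonneg)
  let ?q = "\<lambda>\<omega>. (A *v \<xi> \<omega>) \<bullet> \<xi> \<omega>"
  have qm: "?q \<in> borel_measurable M" unfolding q by measurable
  \<comment> \<open>Enlarging both factors by \<open>e\<close> makes the scale \<open>n + e\<close> admissible for all marginals and the
    divisor \<open>trace_norm A + e\<close> positive; \<open>e\<close> tends to \<open>0\<close> at the end.\<close>
  have key: "psi1_norm M ?q \<le> ennreal ((trace_norm A + e) * (n + e)\<^sup>2)" if e: "e > 0" for e
  proof -
    define L where "L = n + e"
    define T where "T = trace_norm A + e"
    have L: "L > 0" and T: "T > 0" using e n tr0 by (auto simp: L_def T_def)
    have marginal: "(\<integral>\<^sup>+ \<omega>. ennreal (exp ((t \<bullet> \<xi> \<omega>)\<^sup>2 / L\<^sup>2)) \<partial>M) \<le> 2" if "norm t = 1" for t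
    proof -
      have "psi2_norm M (\<lambda>\<omega>. \<xi> \<omega> \<bullet> t) \<le> psi2_vec_norm M \<xi>"
        unfolding psi2_vec_norm_def by (rule SUP_upper) (simp add: that)
      also have "\<dots> < ennreal L" using n e by (simp add: L_def ennreal_less_iff)
      finally show ?thesis
        using psi2_norm_less_imp_exp_moment_le by (simp add: inner_commute)
    qed
    let ?Y = "\<lambda>u \<omega>. \<bar>(v u \<bullet> \<xi> \<omega>) * (u \<bullet> \<xi> \<omega>)\<bar> / L\<^sup>2"
    have "\<bar>?q \<omega>\<bar> / (T * L\<^sup>2) \<le> (\<Sum>u\<in>B. s u / T * ?Y u \<omega>)" for \<omega>
    proof -
      have "\<bar>?q \<omega>\<bar> \<le> (\<Sum>u\<in>B. \<bar>s u * ((v u \<bullet> \<xi> \<omega>) * (u \<bullet> \<xi> \<omega>))\<bar>)"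
        unfolding q by (rule sum_abs)
      also have "\<dots> = (\<Sum>u\<in>B. s u * \<bar>(v u \<bullet> \<xi> \<omega>) * (u \<bullet> \<xi> \<omega>)\<bar>)"
        using s by (intro sum.cong refl) (simp add: abs_mult)
      finally have "\<bar>?q \<omega>\<bar> / (T * L\<^sup>2)
          \<le> (\<Sum>u\<in>B. s u * \<bar>(v u \<bullet> \<xi> \<omega>) * (u \<bullet> \<xi> \<omega>)\<bar>) / (T * L\<^sup>2)"
        using T by (intro divide_right_mono) auto
      then show ?thesis by (simp add: sum_divide_distrib)
    qed
    then have "(\<integral>\<^sup>+ \<omega>. ennreal (exp (\<bar>?q \<omega>\<bar> / (T * L\<^sup>2))) \<partial>M)
        \<le> (\<integral>\<^sup>+ \<omega>. ennreal (exp (\<Sum>u\<in>B. s u / T * ?Y u \<omega>)) \<partial>M)"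
      by (intro nn_integral_mono ennreal_leI) simp
    also have "\<dots> \<le> 2"
    proof (rule exp_moment_convex_combination_le)
      show "(\<Sum>u\<in>B. s u / T) \<le> 1"
        using T e by (simp add: sum_divide_distrib[symmetric] tr) (simp add: T_def)
      show "(\<integral>\<^sup>+ \<omega>. ennreal (exp (?Y u \<omega>)) \<partial>M) \<le> 2" if "u \<in> B" for u
        using that L by (intro exp_moment_product_le marginal nu nv) auto
    qed (use s T in auto)
    finally have "psi1_norm M ?q \<le> ennreal (T * L\<^sup>2)"
      unfolding psi1_norm_def using T L by (intro Inf_lower) auto
    then show ?thesis by (simp add: T_def L_def)
  qed
  have "psi1_norm M ?q \<le> ennreal (trace_norm A * n\<^sup>2)"
  proof (rule tendsto_lowerbound[of _ _ "at_right 0"])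
    have "((\<lambda>e. ennreal ((trace_norm A + e) * (n + e)\<^sup>2))
        \<longlongrightarrow> ennreal ((trace_norm A + 0) * (n + 0)\<^sup>2)) (at_right 0)"
      by (intro tendsto_intros tendsto_ennrealI)
    then show "((\<lambda>e. ennreal ((trace_norm A + e) * (n + e)\<^sup>2))
        \<longlongrightarrow> ennreal (trace_norm A * n\<^sup>2)) (at_right 0)" by simp
    show "\<forall>\<^sub>F e in at_right 0. psi1_norm M ?q \<le> ennreal ((trace_norm A + e) * (n + e)\<^sup>2)"
      using eventually_at_right_less by eventually_elim (rule key)
  qed simp
  also have "\<dots> = ennreal (trace_norm A) * (psi2_vec_norm M \<xi>)\<^sup>2"
    using n tr0 by (simp add: ennreal_mult ennreal_power)
  finally have main: "psi1_norm M ?q \<le> ennreal (trace_norm A) * (psi2_vec_norm M \<xi>)\<^sup>2" .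
  have "ennreal (trace_norm A) * (psi2_vec_norm M \<xi>)\<^sup>2 < \<infinity>"
    using n by (simp add: ennreal_mult_less_top ennreal_power)
  with main have "psi1_norm M ?q < \<infinity>" by order
  with main qm show ?thesis by (simp add: L_psi1_def)
qed

end
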